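(* Let $J_3:\mathbb{N}\to\mathbb{N}$ be the Josephus function with reduction constant $3$, and let $\{n_p^{(\ell)}\}_{\ell\in\mathbb{N}}$ be the strictly increasing enumeration of the fixed points of $J_3$ (so $n_p^{(1)}=1$). For each $\ell$, let $\overline{m}_\ell$ denote the number of pure high extremal points $n$ of $J_3$ with $n_p^{(\ell)}<n<n_p^{(\ell+1)}$. Then for each $\ell\in\mathbb{N}$, \[ \overline{m}_\ell=\max\{m\in\mathbb{Z}_{\ge 0} : 2^m \text{ divides } 3n_p^{(\ell)}+2\}, \] and \[ n_p^{(\ell+1)}=\frac{3^{\overline{m}_\ell}\,(3n_p^{(\ell)}+2)-2^{\overline{m}_\ell}}{2^{\overline{m}_\ell+1}}. \]
   Context: The Josephus function $J_3$: for $n\in\mathbb{N}=\{1,2,\dots\}$, place $n$ people numbered $1,\dots,n$ clockwise in a circle; starting the count at person $1$ and proceeding clockwise, eliminate every third person (the first eliminated is person $3$), the circle closing ranks after each elimination, until one person remains; $J_3(n)$ is the original number of the survivor. Equivalently $J_3(1)=1$ and $J_3(n)=((J_3(n-1)+2)\bmod n)+1$ for $n\ge 2$. A positive integer $n$ is a fixed point of $J_3$ if $J_3(n)=n$, and a pure high extremal point if $J_3(n)=n-1$. (It is known that $J_3$ has infinitely many fixed points.) *)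

theory Defs
  imports Complex_Main "HOL-Library.Infinite_Set"
begin

text \<open>
  The circle is a list read clockwise, whose head is the person at which the count (re)starts.
  Counting off two people moves them to the end of the list; the third one, now at the head, is
  eliminated.  If only two people are left the count wraps around, and so does \<^const>\<open>rotate\<close>.
\<close>

function josephus3_survivor :: "'a list \<Rightarrow> 'a" where
  "josephus3_survivor xs =
     (if length xs \<le> 1 then hd xs else josephus3_survivor (tl (rotate 2 xs)))"
  by auto
termination
  by (relation "measure length") auto

declare josephus3_survivor.simps [simp del]

definition J3 :: "nat \<Rightarrow> nat" where
  "J3 n = josephus3_survivor [1..<n + 1]"

definition J3_fixed_points :: "nat set" where
  "J3_fixed_points = {n. n \<ge> 1 \<and> J3 n = n}"

definition J3_pure_high_points :: "nat set" where
  "J3_pure_high_points = {n. n \<ge> 1 \<and> J3 n = n - 1}"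

text \<open>
  The enumeration is indexed by \<open>l \<ge> 1\<close>, whereas \<^const>\<open>enumerate\<close> starts at 0.
\<close>

definition n_p :: "nat \<Rightarrow> nat" where
  "n_p l = enumerate J3_fixed_points (l - 1)"

definition m_bar :: "nat \<Rightarrow> nat" where
  "m_bar l = card {n \<in> J3_pure_high_points. n_p l < n \<and> n < n_p (l + 1)}"

lemma josephus3_survivor_map:
  "xs \<noteq> [] \<Longrightarrow> josephus3_survivor (map f xs) = f (josephus3_survivor xs)"
proof (induction xs rule: josephus3_survivor.induct)
  case (1 xs)
  show ?case
  proof (cases "length xs \<le> 1")
    case True
    with "1.prems" show ?thesis
      by (simp add: josephus3_survivor.simps[of xs] josephus3_survivor.simps[of "map f xs"] hd_map)
  next
    case False
    then have "length (tl (rotate 2 xs)) > 0"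
      by simp
    then have "tl (rotate 2 xs) \<noteq> []"
      by (metis length_greater_0_conv)
    with "1.IH" False show ?thesis
      by (simp add: josephus3_survivor.simps[of xs] josephus3_survivor.simps[of "map f xs"]
          rotate_map flip: map_tl)
  qed
qed

lemma J3_1: "J3 1 = 1"
  by (simp add: J3_def josephus3_survivor.simps)

lemma J3_rec:
  assumes "n \<ge> 2"
  shows "J3 n = (J3 (n - 1) + 2) mod n + 1"
proof -
  have "tl (rotate 2 [1..<n + 1]) = map (\<lambda>i. (i + 2) mod n + 1) [1..<n]"
  proof (rule nth_equalityI)
    show "length (tl (rotate 2 [1..<n + 1])) = length (map (\<lambda>i. (i + 2) mod n + 1) [1..<n])"
      by (simp del: upt_Suc)
  next
    fix i assume "i < length (tl (rotate 2 [1..<n + 1]))"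
    then have i: "i < n - 1"
      by (simp del: upt_Suc)
    have "tl (rotate 2 [1..<n + 1]) ! i = rotate 2 [1..<n + 1] ! Suc i"
      using i by (intro nth_tl) (simp del: upt_Suc)
    also have "\<dots> = [1..<n + 1] ! ((2 + Suc i) mod n)"
      using i by (subst nth_rotate) (auto simp del: upt_Suc)
    also have "\<dots> = 1 + (2 + Suc i) mod n"
    proof -
      have "(2 + Suc i) mod n < n"
        using assms by simp
      then show ?thesis
        by (subst nth_upt) (auto simp del: upt_Suc)
    qed
    also have "\<dots> = map (\<lambda>i. (i + 2) mod n + 1) [1..<n] ! i"
      using i by simp
    finally show "tl (rotate 2 [1..<n + 1]) ! i = map (\<lambda>i. (i + 2) mod n + 1) [1..<n] ! i" .
  qed
  then have "J3 n = josephus3_survivor (map (\<lambda>i. (i + 2) mod n + 1) [1..<n])"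
    using assms unfolding J3_def by (subst josephus3_survivor.simps) (simp del: upt_Suc)
  also have "\<dots> = (J3 (n - 1) + 2) mod n + 1"
    using assms by (subst josephus3_survivor_map) (auto simp: J3_def simp del: upt_Suc)
  finally show ?thesis .
qed

lemma n_p_1: "n_p 1 = 1"
proof -
  have "(LEAST n. n \<in> J3_fixed_points) = 1"
    by (rule Least_equality) (use J3_1 in \<open>auto simp: J3_fixed_points_def\<close>)
  then show ?thesis
    by (simp add: n_p_def enumerate_0)
qed

end

theory Submission
  imports Defs "HOL-Computational_Algebra.Primes"
begin

text \<open>
  The potential \<open>w n = 3 n + 1 - J3 n\<close> is unchanged from \<open>n\<close> to \<open>n + 1\<close> if \<open>n\<close> is neither a fixed
  point nor a pure high point, because \<open>J3\<close> then grows by 3, and it is multiplied by \<open>3 / 2\<close> if \<open>n\<close>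
  is a pure high point.  Hence \<open>2 ^ c * w m = 3 ^ c * w n\<close> if there are \<open>c\<close> pure high points and no
  fixed points from \<open>n\<close> up to \<open>m\<close>.  Here \<open>2 ^ c\<close> divides \<open>w n\<close>, so \<open>c\<close> and thus \<open>w m \<ge> 2 m + 1\<close> are
  bounded, which forces a next fixed point.  Just after a fixed point \<open>n\<close> the potential is \<open>3 n + 2\<close>,
  at the next fixed point \<open>p\<close> it is \<open>2 p + 1\<close>, so \<open>2 ^ c * (2 p + 1) = 3 ^ c * (3 n + 2)\<close>; as
  \<open>2 p + 1\<close> and \<open>3 ^ c\<close> are odd, \<open>c\<close> is the 2-adic valuation of \<open>3 n + 2\<close>.
\<close>

lemma J3_le:
  assumes "n \<ge> 1"
  shows "J3 n \<le> n"
proof (cases "n = 1")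
  case True
  then show ?thesis
    using J3_1 by simp
next
  case False
  then have "(J3 (n - 1) + 2) mod n < n"
    using assms by simp
  then show ?thesis
    using J3_rec[of n] False assms by linarith
qed

definition J3_potential :: "nat \<Rightarrow> nat" where
  "J3_potential n = 3 * n + 1 - J3 n"

lemma J3_potential_ge:
  assumes "n \<ge> 1"
  shows "2 * n + 1 \<le> J3_potential n"
  using J3_le[OF assms] by (simp add: J3_potential_def)

lemma J3_potential_fixed_point:
  assumes "n \<in> J3_fixed_points"
  shows "J3_potential n = 2 * n + 1"
  using assms by (simp add: J3_potential_def J3_fixed_points_def)

lemma J3_potential_Suc_fixed_point:
  assumes "n \<in> J3_fixed_points"
  shows "J3_potential (Suc n) = 3 * n + 2"
proof -
  have n: "n \<ge> 1" "J3 n = n"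
    using assms by (auto simp: J3_fixed_points_def)
  then have "(n + 2) mod Suc n = 1"
    by (simp add: mod_if)
  then have "J3 (Suc n) = 2"
    using J3_rec[of "Suc n"] n by simp
  then show ?thesis
    by (simp add: J3_potential_def)
qed

lemma J3_potential_Suc_pure_high_point:
  assumes "n \<in> J3_pure_high_points"
  shows "2 * J3_potential (Suc n) = 3 * J3_potential n"
proof -
  have n: "n \<ge> 1" "J3 n = n - 1"
    using assms by (auto simp: J3_pure_high_points_def)
  then have "J3 (Suc n) = 1"
    using J3_rec[of "Suc n"] by simp
  then show ?thesis
    using n by (simp add: J3_potential_def)
qed

lemma J3_potential_Suc_eq:
  assumes "n \<ge> 1" "n \<notin> J3_fixed_points" "n \<notin> J3_pure_high_points"
  shows "J3_potential (Suc n) = J3_potential n"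
proof -
  have "J3 n + 2 \<le> n"
    using assms J3_le[of n] by (auto simp: J3_fixed_points_def J3_pure_high_points_def)
  then have "J3 (Suc n) = J3 n + 3"
    using J3_rec[of "Suc n"] assms(1) by simp
  then show ?thesis
    by (simp add: J3_potential_def)
qed

lemma J3_potential_fixed_point_free:
  assumes "n \<ge> 1" "n \<le> m" "J3_fixed_points \<inter> {n..<m} = {}"
  defines "c \<equiv> \<lambda>m. card (J3_pure_high_points \<inter> {n..<m})"
  shows "2 ^ c m * J3_potential m = 3 ^ c m * J3_potential n"
  using assms(2,3)
proof (induction m rule: dec_induct)
  case base
  show ?case
    by (simp add: c_def)
next
  case (step m)
  have before: "2 ^ c m * J3_potential m = 3 ^ c m * J3_potential n"
    using step by (auto simp: atLeastLessThanSuc)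
  have m: "m \<ge> 1" "m \<notin> J3_fixed_points"
    using step assms(1) by auto
  show ?case
  proof (cases "m \<in> J3_pure_high_points")
    case True
    then have card_Suc: "c (Suc m) = Suc (c m)"
      using step by (simp add: c_def atLeastLessThanSuc)
    then have "2 ^ c (Suc m) * J3_potential (Suc m) = 2 ^ c m * (2 * J3_potential (Suc m))"
      by simp
    also have "\<dots> = 3 * (2 ^ c m * J3_potential m)"
      using J3_potential_Suc_pure_high_point[OF True] by simp
    also have "\<dots> = 3 ^ c (Suc m) * J3_potential n"
      using before card_Suc by simp
    finally show ?thesis .
  next
    case False
    then have "c (Suc m) = c m"
      using step by (simp add: c_def atLeastLessThanSuc)
    then show ?thesis
      using before J3_potential_Suc_eq m False by simp
  qed
qed

lemma card_pure_high_points_le_J3_potential: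
  assumes "n \<ge> 1" "n \<le> m" "J3_fixed_points \<inter> {n..<m} = {}"
  shows "card (J3_pure_high_points \<inter> {n..<m}) \<le> J3_potential n"
proof -
  define c where "c = card (J3_pure_high_points \<inter> {n..<m})"
  have "2 ^ c dvd 3 ^ c * J3_potential n"
    using J3_potential_fixed_point_free[OF assms, folded c_def] by (metis dvd_triv_left)
  then have "2 ^ c dvd J3_potential n"
    by (simp add: coprime_dvd_mult_right_iff)
  moreover have "J3_potential n > 0"
    using J3_potential_ge[OF assms(1)] by simp
  ultimately have "2 ^ c \<le> J3_potential n"
    by (rule dvd_imp_le)
  then show ?thesis
    using less_exp[of c] unfolding c_def by linarith
qed

lemma infinite_J3_fixed_points: "infinite J3_fixed_points"
proof
  assume "finite J3_fixed_points"
  then obtain n where n: "J3_fixed_points \<subseteq> {..<n}"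
    using finite_nat_bounded by blast
  moreover have "1 \<in> J3_fixed_points"
    using J3_1 by (simp add: J3_fixed_points_def)
  ultimately have "n \<ge> 1"
    by force
  define w where "w = J3_potential n"
  have bound: "2 * m + 1 \<le> 3 ^ w * w" if "m \<ge> n" for m
  proof -
    define c where "c = card (J3_pure_high_points \<inter> {n..<m})"
    have fixed_point_free: "J3_fixed_points \<inter> {n..<m} = {}"
      using n by fastforce
    have "c \<le> w"
      using card_pure_high_points_le_J3_potential[OF \<open>n \<ge> 1\<close> that fixed_point_free]
      by (simp add: c_def w_def)
    have "2 * m + 1 \<le> J3_potential m"
      using \<open>n \<ge> 1\<close> that by (intro J3_potential_ge) simp
    also have "\<dots> \<le> 2 ^ c * J3_potential m"
      by simp
    also have "\<dots> = 3 ^ c * w"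
      unfolding c_def w_def using \<open>n \<ge> 1\<close> that fixed_point_free
      by (rule J3_potential_fixed_point_free)
    also have "\<dots> \<le> 3 ^ w * w"
      using \<open>c \<le> w\<close> by (simp add: power_increasing)
    finally show ?thesis .
  qed
  from bound[of "n + 3 ^ w * w"] show False
    by simp
qed

lemma n_p_in_J3_fixed_points: "n_p l \<in> J3_fixed_points"
  unfolding n_p_def using infinite_J3_fixed_points by (rule enumerate_in_set)

lemma n_p_less_Suc:
  assumes "l \<ge> 1"
  shows "n_p l < n_p (l + 1)"
  using assms enumerate_step[OF infinite_J3_fixed_points, of "l - 1"] by (simp add: n_p_def)

lemma no_fixed_point_between_n_p:
  assumes "l \<ge> 1"
  shows "J3_fixed_points \<inter> {n_p l<..<n_p (l + 1)} = {}"
proof -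
  have "n_p (l + 1) = (LEAST p. p \<in> J3_fixed_points \<and> n_p l < p)"
    using assms enumerate_Suc''[OF infinite_J3_fixed_points, of "l - 1"] by (simp add: n_p_def)
  then show ?thesis
    using not_less_Least by fastforce
qed

lemma power_m_bar_n_p_Suc_eq:
  assumes "l \<ge> 1"
  shows "2 ^ m_bar l * (2 * n_p (l + 1) + 1) = 3 ^ m_bar l * (3 * n_p l + 2)"
proof -
  have between: "{Suc (n_p l)..<n_p (l + 1)} = {n_p l<..<n_p (l + 1)}"
    by (rule atLeastSucLessThan_greaterThanLessThan)
  have "J3_pure_high_points \<inter> {n_p l<..<n_p (l + 1)}
      = {n \<in> J3_pure_high_points. n_p l < n \<and> n < n_p (l + 1)}"
    by auto
  then have "2 ^ m_bar l * J3_potential (n_p (l + 1)) = 3 ^ m_bar l * J3_potential (Suc (n_p l))"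
    using J3_potential_fixed_point_free[of "Suc (n_p l)" "n_p (l + 1)", unfolded between]
      n_p_less_Suc[OF assms] no_fixed_point_between_n_p[OF assms]
    by (simp add: m_bar_def)
  then show ?thesis
    by (simp add: J3_potential_fixed_point J3_potential_Suc_fixed_point n_p_in_J3_fixed_points)
qed

theorem theorem3:
  fixes l :: nat
  assumes "l \<ge> 1"
  shows "m_bar l = Max {m :: nat. 2 ^ m dvd 3 * n_p l + 2}
    \<and> real (n_p (l + 1)) =
        (3 ^ m_bar l * (3 * real (n_p l) + 2) - 2 ^ m_bar l) / 2 ^ (m_bar l + 1)"
proof
  have power_eq: "2 ^ m_bar l * (2 * n_p (l + 1) + 1) = 3 ^ m_bar l * (3 * n_p l + 2)"
    using assms by (rule power_m_bar_n_p_Suc_eq)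
  have "m_bar l = multiplicity 2 (3 ^ m_bar l * (3 * n_p l + 2))"
    by (rule multiplicity_decomposeI[OF power_eq[symmetric], symmetric]) auto
  also have "\<dots> = multiplicity 2 (3 * n_p l + 2)"
    by (rule multiplicity_prime_elem_times_other) auto
  also have "\<dots> = Max {m. 2 ^ m dvd 3 * n_p l + 2}"
    by (simp add: multiplicity_def finite_divisor_powers)
  finally show "m_bar l = Max {m. 2 ^ m dvd 3 * n_p l + 2}" .
  have "2 ^ m_bar l * (2 * real (n_p (l + 1)) + 1) = 3 ^ m_bar l * (3 * real (n_p l) + 2)"
    using arg_cong[OF power_eq, of real] by (simp add: algebra_simps)
  then show "real (n_p (l + 1)) =
      (3 ^ m_bar l * (3 * real (n_p l) + 2) - 2 ^ m_bar l) / 2 ^ (m_bar l + 1)"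
    by (simp add: field_simps)
qed

end
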